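(* Let $n\in\mathbb{N}$ and let $V$ be a real vector space. Let $T:V[x_1,\dots,x_n]\to V[x_1,\dots,x_n]$ be a linear operator, i.e., $T(af+g)=a\cdot Tf+Tg$ for all $a\in\mathbb{R}$ and $f,g\in V[x_1,\dots,x_n]$. Then, for all $\alpha\in\mathbb{N}_0^n$, there exist unique linear operators $Q_\alpha:V\to V[x_1,\dots,x_n]$ such that $$T=\sum_{\alpha\in\mathbb{N}_0^n}\frac1{\alpha!}\cdot Q_\alpha\times\partial^\alpha\qquad\text{with}\qquad(Q_\alpha\times\partial^\alpha)(v\cdot x^\beta):=Q_\alpha(v)\cdot\partial^\alpha x^\beta$$ for all $\alpha,\beta\in\mathbb{N}_0^n$ and $v\in V$.
   Context: $V[x_1,\dots,x_n]=V\otimes\mathbb{R}[x_1,\dots,x_n]$ is the real vector space of polynomials in $x_1,\dots,x_n$ with coefficients in $V$, i.e., finite sums $\sum_\beta v_\beta x^\beta$ with $v_\beta\in V$; elements of $V[x_1,\dots,x_n]$ can be multiplied by elements of $\mathbb{R}[x_1,\dots,x_n]$. $Q_\alpha\times\partial^\alpha$ is extended linearly from the elements $v x^\beta$ to $V[x_1,\dots,x_n]$. The infinite sum is finite when applied to any fixed polynomial, since $\partial^\alpha x^\beta=0$ unless $\alpha\le\beta$ componentwise. $\mathbb{N}_0=\{0,1,2,\dots\}$, $\alpha!=\alpha_1!\cdots\alpha_n!$, $\partial^\alpha=\partial_1^{\alpha_1}\cdots\partial_n^{\alpha_n}$. *)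

theory Defs
  imports "HOL-Analysis.Finite_Function_Topology"
begin

text \<open>
  The number \<open>n \<ge> 1\<close> of variables is the cardinality of the finite index type \<open>'n\<close>, exponents
  \<open>\<alpha> \<in> \<nat>\<^sub>0\<^sup>n\<close> are elements of \<open>'n \<Rightarrow>\<^sub>0 nat\<close>, and \<open>v x\<^sup>\<beta>\<close> is \<open>Poly_Mapping.single \<beta> v\<close>.
  The real vector space structure of \<open>V[x]\<close> is the instance from
  \<^theory>\<open>HOL-Analysis.Finite_Function_Topology\<close>, and \<open>\<real>[x]\<close> is the case \<open>V = \<real>\<close>.
\<close>

type_synonym ('n, 'v) vpoly = "('n \<Rightarrow>\<^sub>0 nat) \<Rightarrow>\<^sub>0 'v"

definition vpoly_mult ::
    "('n, 'v::real_vector) vpoly \<Rightarrow> ('n, real) vpoly \<Rightarrow> ('n, 'v) vpoly"  (infixl "\<odot>" 70)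
  where "f \<odot> p =
    (\<Sum>\<beta>\<in>Poly_Mapping.keys f. \<Sum>\<gamma>\<in>Poly_Mapping.keys p.
       Poly_Mapping.single (\<beta> + \<gamma>) (Poly_Mapping.lookup p \<gamma> *\<^sub>R Poly_Mapping.lookup f \<beta>))"

text \<open>
  \<open>\<partial>\<^sub>i x\<^sup>\<beta> = \<beta>\<^sub>i x\<^bsup>\<beta> - e\<^sub>i\<^esup>\<close>, extended linearly; for \<open>\<beta>\<^sub>i = 0\<close> the subtraction of exponents
  truncates, but the coefficient vanishes.
\<close>

definition partial :: "'n \<Rightarrow> ('n, real) vpoly \<Rightarrow> ('n, real) vpoly"
  where "partial i p =
    (\<Sum>\<beta>\<in>Poly_Mapping.keys p.
       Poly_Mapping.single (\<beta> - Poly_Mapping.single i 1)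
         (real (Poly_Mapping.lookup \<beta> i) * Poly_Mapping.lookup p \<beta>))"

text \<open>
  \<open>\<partial>\<^sup>\<alpha>\<close> composes the \<open>\<partial>\<^sub>i\<^bsup>\<alpha>\<^sub>i\<^esup>\<close> over all \<open>i\<close>; the index type carries no order, and the fold is
  meaningful because the factors commute (see \<open>comp_fun_commute_partial\<close> below).
\<close>

definition mpartial :: "('n::finite \<Rightarrow>\<^sub>0 nat) \<Rightarrow> ('n, real) vpoly \<Rightarrow> ('n, real) vpoly"
  where "mpartial \<alpha> p =
    Finite_Set.fold (\<lambda>i. partial i ^^ Poly_Mapping.lookup \<alpha> i) p UNIV"

definition mfact :: "('n::finite \<Rightarrow>\<^sub>0 nat) \<Rightarrow> real"
  where "mfact \<alpha> = (\<Prod>i\<in>UNIV. fact (Poly_Mapping.lookup \<alpha> i))"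

text \<open>
  \<open>(Q \<times> \<partial>\<^sup>\<alpha>)(v x\<^sup>\<beta>) = Q(v) \<partial>\<^sup>\<alpha> x\<^sup>\<beta>\<close>, extended linearly along \<open>f = (\<Sum>\<beta>. f\<^sub>\<beta> x\<^sup>\<beta>)\<close>.
\<close>

definition op_times_partial ::
    "('v::real_vector \<Rightarrow> ('n::finite, 'v) vpoly) \<Rightarrow> ('n \<Rightarrow>\<^sub>0 nat) \<Rightarrow> ('n, 'v) vpoly \<Rightarrow> ('n, 'v) vpoly"
  where "op_times_partial Q \<alpha> f =
    (\<Sum>\<beta>\<in>Poly_Mapping.keys f.
       Q (Poly_Mapping.lookup f \<beta>) \<odot> mpartial \<alpha> (Poly_Mapping.single \<beta> 1))"

text \<open>
  \<^const>\<open>Sum_any\<close> sums over the \<open>\<alpha>\<close> whose summand is nonzero; there are only finitely many of them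
  (see \<open>finite_op_times_partial\<close> below).
\<close>

definition diffop_series ::
    "(('n::finite \<Rightarrow>\<^sub>0 nat) \<Rightarrow> 'v::real_vector \<Rightarrow> ('n, 'v) vpoly) \<Rightarrow> ('n, 'v) vpoly \<Rightarrow> ('n, 'v) vpoly"
  where "diffop_series Q f = Sum_any (\<lambda>\<alpha>. (1 / mfact \<alpha>) *\<^sub>R op_times_partial (Q \<alpha>) \<alpha> f)"


lemma lookup_scaleR_poly [simp]:
  "Poly_Mapping.lookup (a *\<^sub>R f) k = a *\<^sub>R Poly_Mapping.lookup f k"
proof -
  have "finite {i. a *\<^sub>R Poly_Mapping.lookup f i \<noteq> 0}"
    by (rule finite_subset[OF _ finite_lookup[of f]]) auto
  then show ?thesis
    by (simp add: scaleR_poly_mapping_def)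
qed

lemma partial_0 [simp]: "partial i 0 = 0"
  by (simp add: partial_def)

lemma partial_single:
  "partial i (Poly_Mapping.single \<beta> c) =
    Poly_Mapping.single (\<beta> - Poly_Mapping.single i 1) (real (Poly_Mapping.lookup \<beta> i) * c)"
  by (cases "c = 0") (simp_all add: partial_def)

lemma lookup_partial:
  "Poly_Mapping.lookup (partial i p) \<gamma> =
    real (Suc (Poly_Mapping.lookup \<gamma> i)) * Poly_Mapping.lookup p (\<gamma> + Poly_Mapping.single i 1)"
proof -
  let ?e = "Poly_Mapping.single i (1::nat)"
  have eq: "(real (Poly_Mapping.lookup \<beta> i) * Poly_Mapping.lookup p \<beta> when \<beta> - ?e = \<gamma>) =
      (if \<beta> = \<gamma> + ?e then real (Suc (Poly_Mapping.lookup \<gamma> i)) * Poly_Mapping.lookup p (\<gamma> + ?e) else 0)"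
    for \<beta>
  proof (cases "Poly_Mapping.lookup \<beta> i = 0")
    case True
    then have "\<beta> \<noteq> \<gamma> + ?e" by (auto simp: lookup_add)
    with True show ?thesis by simp
  next
    case False
    have "\<beta> - ?e + ?e = \<beta>"
      using False by (intro poly_mapping_eqI) (auto simp: lookup_add lookup_minus lookup_single when_def)
    then have "\<beta> - ?e = \<gamma> \<longleftrightarrow> \<beta> = \<gamma> + ?e" by (metis add_diff_cancel_right')
    then show ?thesis by (auto simp: lookup_add)
  qed
  have "Poly_Mapping.lookup (partial i p) \<gamma> =
      (\<Sum>\<beta>\<in>Poly_Mapping.keys p.
        if \<beta> = \<gamma> + ?e then real (Suc (Poly_Mapping.lookup \<gamma> i)) * Poly_Mapping.lookup p (\<gamma> + ?e) else 0)"
    unfolding partial_def lookup_sum lookup_single eq ..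
  then show ?thesis by (simp add: in_keys_iff)
qed

lemma partial_commute: "partial i (partial j p) = partial j (partial i p)"
  by (cases "i = j")
     (auto intro!: poly_mapping_eqI simp: lookup_partial lookup_add lookup_single ac_simps)

lemma comp_fun_commute_partial:
  "comp_fun_commute (\<lambda>i. partial i ^^ Poly_Mapping.lookup \<alpha> i)"
proof -
  interpret comp_fun_commute partial
    by standard (simp add: fun_eq_iff partial_commute)
  show ?thesis by (rule comp_fun_commute_funpow)
qed

lemma mpartial_single_eq_0:
  assumes "Poly_Mapping.lookup \<beta> i < Poly_Mapping.lookup \<alpha> i"
  shows "mpartial \<alpha> (Poly_Mapping.single \<beta> c) = 0"
proof -
  let ?F = "\<lambda>i. partial i ^^ Poly_Mapping.lookup \<alpha> i"
  interpret comp_fun_commute ?F by (rule comp_fun_commute_partial)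
  have Z: "(partial j ^^ k) 0 = 0" for j k by (induction k) auto
  have *: "(partial i ^^ k) (Poly_Mapping.single \<beta> c) = 0"
    if "Poly_Mapping.lookup \<beta> i < k" for k and \<beta> :: "'a \<Rightarrow>\<^sub>0 nat" and c
    using that
  proof (induction k arbitrary: \<beta> c)
    case (Suc k)
    show ?case
    proof (cases "Poly_Mapping.lookup \<beta> i = 0")
      case True
      then show ?thesis by (simp add: funpow_Suc_right partial_single Z del: funpow.simps)
    next
      case False
      then have "Poly_Mapping.lookup (\<beta> - Poly_Mapping.single i 1) i < k"
        using Suc.prems by (simp add: lookup_minus)
      then show ?thesis
        by (simp add: funpow_Suc_right partial_single Suc.IH del: funpow.simps)
    qed
  qed simp
  have "mpartial \<alpha> (Poly_Mapping.single \<beta> c) =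
      Finite_Set.fold ?F (?F i (Poly_Mapping.single \<beta> c)) (UNIV - {i})"
    unfolding mpartial_def
    using fold_insert2[of "UNIV - {i}" i] by (simp add: insert_UNIV)
  also have "\<dots> = Finite_Set.fold ?F 0 (UNIV - {i})"
    using *[OF assms] by simp
  also have "Finite_Set.fold ?F 0 A = 0" if "finite A" for A
    using that by induction (simp_all add: Z)
  then have "Finite_Set.fold ?F 0 (UNIV - {i}) = 0" by simp
  finally show ?thesis .
qed

lemma finite_op_times_partial: "finite {\<alpha>. op_times_partial (Q \<alpha>) \<alpha> f \<noteq> 0}"
proof (rule finite_subset)
  show "{\<alpha>. op_times_partial (Q \<alpha>) \<alpha> f \<noteq> 0} \<subseteq>
      (\<Union>\<beta>\<in>Poly_Mapping.keys f. {\<alpha>. \<forall>i. Poly_Mapping.lookup \<alpha> i \<le> Poly_Mapping.lookup \<beta> i})"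
  proof (clarify, rule ccontr)
    fix \<alpha>
    assume nz: "op_times_partial (Q \<alpha>) \<alpha> f \<noteq> 0"
      and "\<alpha> \<notin> (\<Union>\<beta>\<in>Poly_Mapping.keys f. {\<alpha>. \<forall>i. Poly_Mapping.lookup \<alpha> i \<le> Poly_Mapping.lookup \<beta> i})"
    then have "mpartial \<alpha> (Poly_Mapping.single \<beta> 1) = 0" if "\<beta> \<in> Poly_Mapping.keys f" for \<beta>
      using that by (auto simp: not_le intro: mpartial_single_eq_0)
    then have "op_times_partial (Q \<alpha>) \<alpha> f = 0"
      by (simp add: op_times_partial_def vpoly_mult_def)
    with nz show False ..
  qed
  have "finite {\<alpha>. \<forall>i. Poly_Mapping.lookup \<alpha> i \<le> Poly_Mapping.lookup \<beta> i}" for \<beta> :: "'a \<Rightarrow>\<^sub>0 nat"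
  proof (rule finite_imageD)
    have "Poly_Mapping.lookup ` {\<alpha>. \<forall>i. Poly_Mapping.lookup \<alpha> i \<le> Poly_Mapping.lookup \<beta> i}
        \<subseteq> PiE UNIV (\<lambda>i. {..Poly_Mapping.lookup \<beta> i})"
      by auto
    then show "finite (Poly_Mapping.lookup ` {\<alpha>. \<forall>i. Poly_Mapping.lookup \<alpha> i \<le> Poly_Mapping.lookup \<beta> i})"
      by (rule finite_subset) (intro finite_PiE, auto)
  qed (rule inj_onI, simp add: poly_mapping_eqI)
  then show "finite (\<Union>\<beta>\<in>Poly_Mapping.keys f.
      {\<alpha>. \<forall>i. Poly_Mapping.lookup \<alpha> i \<le> Poly_Mapping.lookup \<beta> i})"
    by simp
qed

lemma op_times_partial_single:
  assumes "linear Q"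
  shows "op_times_partial Q \<alpha> (Poly_Mapping.single \<beta> v) = Q v \<odot> mpartial \<alpha> (Poly_Mapping.single \<beta> 1)"
  using linear_0[OF assms] by (cases "v = 0") (simp_all add: op_times_partial_def vpoly_mult_def)

lemma vpoly_mult_superset:
  assumes "finite A" "Poly_Mapping.keys f \<subseteq> A"
  shows "f \<odot> p = (\<Sum>\<beta>\<in>A. \<Sum>\<gamma>\<in>Poly_Mapping.keys p.
     Poly_Mapping.single (\<beta> + \<gamma>) (Poly_Mapping.lookup p \<gamma> *\<^sub>R Poly_Mapping.lookup f \<beta>))"
  unfolding vpoly_mult_def
  using assms by (intro sum.mono_neutral_left) (auto simp: in_keys_iff)

lemma single_scaleR: "Poly_Mapping.single k (a *\<^sub>R v) = a *\<^sub>R Poly_Mapping.single k v"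
  by (rule poly_mapping_eqI) (simp add: lookup_single when_def)

lemma vpoly_mult_linear: "linear (\<lambda>f. f \<odot> p)"
proof (rule linearI)
  fix f g :: "('a, 'b) vpoly" and a :: real
  let ?A = "Poly_Mapping.keys f \<union> Poly_Mapping.keys g \<union> Poly_Mapping.keys (f + g)"
  let ?B = "Poly_Mapping.keys f \<union> Poly_Mapping.keys (a *\<^sub>R f)"
  show "(f + g) \<odot> p = f \<odot> p + g \<odot> p"
    by (subst (1 2 3) vpoly_mult_superset[where A = ?A])
       (auto simp: lookup_add scaleR_add_right single_add sum.distrib)
  show "(a *\<^sub>R f) \<odot> p = a *\<^sub>R (f \<odot> p)"
    by (subst (1 2) vpoly_mult_superset[where A = ?B])
       (auto simp: scaleR_sum_right single_scaleR mult.commute)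
qed

lemma linear_op_times_partial:
  fixes Q :: "'v::real_vector \<Rightarrow> ('n::finite, 'v) vpoly"
  assumes "linear Q"
  shows "linear (op_times_partial Q \<alpha>)"
proof (rule linearI)
  let ?T = "\<lambda>\<beta> v. Q v \<odot> mpartial \<alpha> (Poly_Mapping.single \<beta> 1)"
  have lin: "linear (?T \<beta>)" for \<beta>
    using linear_compose[OF assms vpoly_mult_linear] by (simp add: o_def)
  have sup: "op_times_partial Q \<alpha> f = (\<Sum>\<beta>\<in>A. ?T \<beta> (Poly_Mapping.lookup f \<beta>))"
    if "finite A" "Poly_Mapping.keys f \<subseteq> A" for f A
    unfolding op_times_partial_def
    using that linear_0[OF lin] by (intro sum.mono_neutral_left) (auto simp: in_keys_iff)
  fix f g :: "('n, 'v) vpoly" and a :: real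
  let ?A = "Poly_Mapping.keys f \<union> Poly_Mapping.keys g \<union> Poly_Mapping.keys (f + g)"
  let ?B = "Poly_Mapping.keys f \<union> Poly_Mapping.keys (a *\<^sub>R f)"
  show "op_times_partial Q \<alpha> (f + g) = op_times_partial Q \<alpha> f + op_times_partial Q \<alpha> g"
    by (subst (1 2 3) sup[where A = ?A])
       (auto simp: lookup_add linear_add[OF lin] sum.distrib)
  show "op_times_partial Q \<alpha> (a *\<^sub>R f) = a *\<^sub>R op_times_partial Q \<alpha> f"
    by (subst (1 2) sup[where A = ?B])
       (auto simp: linear_scale[OF lin] scaleR_sum_right)
qed

end

theory Submission
  imports Defs
begin

text \<open>
  Since \<open>\<partial>\<^sup>\<alpha> x\<^sup>\<beta>\<close> vanishes unless \<open>\<alpha> \<le> \<beta>\<close> and \<open>\<partial>\<^sup>\<beta> x\<^sup>\<beta> = \<beta>!\<close>, evaluating the series at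
  \<open>v x\<^sup>\<beta>\<close> gives \<open>Q\<^sub>\<beta>(v)\<close> plus terms that involve only \<open>Q\<^sub>\<alpha>(v)\<close> with \<open>\<alpha> < \<beta>\<close>.
  The equation \<open>T = \<Sum>\<^sub>\<alpha> 1/\<alpha>! Q\<^sub>\<alpha> \<times> \<partial>\<^sup>\<alpha>\<close>, which by linearity need only be tested on the elements
  \<open>v x\<^sup>\<beta>\<close>, is therefore a unitriangular system for the \<open>Q\<^sub>\<alpha>\<close>, solved recursively and uniquely.
\<close>

lemma poly_mapping_eq_sum_single:
  "f = (\<Sum>k\<in>Poly_Mapping.keys f. Poly_Mapping.single k (Poly_Mapping.lookup f k))"
  by (rule poly_mapping_eqI) (auto simp: lookup_sum lookup_single when_def in_keys_iff)

text \<open>The monomials v x^k span V[x]; this reduces the operator identity to the triangular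
  system.\<close>

lemma linear_eq_on_singles:
  fixes S T :: "('k \<Rightarrow>\<^sub>0 'v::real_vector) \<Rightarrow> 'w::real_vector"
  assumes "linear S" "linear T"
    and "\<And>k v. S (Poly_Mapping.single k v) = T (Poly_Mapping.single k v)"
  shows "S = T"
proof
  fix f :: "'k \<Rightarrow>\<^sub>0 'v"
  let ?s = "\<lambda>k. Poly_Mapping.single k (Poly_Mapping.lookup f k)"
  have "S (sum ?s (Poly_Mapping.keys f)) = T (sum ?s (Poly_Mapping.keys f))"
    by (simp add: linear_sum[OF assms(1)] linear_sum[OF assms(2)] assms(3))
  then show "S f = T f"
    by (simp flip: poly_mapping_eq_sum_single)
qed

lemma linear_single: "linear (Poly_Mapping.single k :: 'v::real_vector \<Rightarrow> 'k \<Rightarrow>\<^sub>0 'v)"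
  by (rule linearI) (simp_all add: single_add single_scaleR)

lemma vpoly_mult_const: "f \<odot> Poly_Mapping.single 0 c = c *\<^sub>R f"
proof (cases "c = 0")
  case False
  then have "f \<odot> Poly_Mapping.single 0 c =
      c *\<^sub>R (\<Sum>\<beta>\<in>Poly_Mapping.keys f. Poly_Mapping.single \<beta> (Poly_Mapping.lookup f \<beta>))"
    by (simp add: vpoly_mult_def single_scaleR scaleR_sum_right)
  then show ?thesis
    by (simp flip: poly_mapping_eq_sum_single)
qed (simp add: vpoly_mult_def)

text \<open>Splitting the power of x_i off as a summand keeps the subtraction of exponents from
  truncating, and the derivatives collect k (k-1) ... 1.\<close>

lemma partial_funpow_single:
  assumes "Poly_Mapping.lookup \<gamma> i = 0"
  shows "(partial i ^^ k) (Poly_Mapping.single (\<gamma> + Poly_Mapping.single i k) c) =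
    Poly_Mapping.single \<gamma> (fact k * c)"
proof (induction k arbitrary: c)
  case (Suc k)
  have "\<gamma> + Poly_Mapping.single i (Suc k) - Poly_Mapping.single i 1 = \<gamma> + Poly_Mapping.single i k"
    by (rule poly_mapping_eqI) (simp add: lookup_add lookup_minus lookup_single when_def)
  then show ?case
    using assms
    by (simp add: funpow_Suc_right partial_single lookup_add Suc.IH algebra_simps del: funpow.simps)
qed simp

text \<open>Each derivative strips one variable and leaves the other exponents alone. A general
  finite \<open>A\<close>, with \<open>\<gamma>\<close> carrying the untouched exponents, allows
  induction on the index set.\<close>

lemma fold_partial_single:
  fixes \<alpha> :: "'n \<Rightarrow>\<^sub>0 nat"
  assumes "finite A" "\<And>i. i \<in> A \<Longrightarrow> Poly_Mapping.lookup \<gamma> i = 0"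
  shows "Finite_Set.fold (\<lambda>i. partial i ^^ Poly_Mapping.lookup \<alpha> i)
      (Poly_Mapping.single (\<gamma> + (\<Sum>i\<in>A. Poly_Mapping.single i (Poly_Mapping.lookup \<alpha> i))) c) A =
    Poly_Mapping.single \<gamma> ((\<Prod>i\<in>A. fact (Poly_Mapping.lookup \<alpha> i)) * c)"
  using assms
proof (induction A arbitrary: c)
  case (insert x A)
  interpret comp_fun_commute "\<lambda>i. partial i ^^ Poly_Mapping.lookup \<alpha> i"
    by (rule comp_fun_commute_partial)
  let ?\<alpha> = "\<lambda>i. Poly_Mapping.lookup \<alpha> i"
  let ?\<delta> = "\<gamma> + (\<Sum>i\<in>A. Poly_Mapping.single i (?\<alpha> i))"
  have "Poly_Mapping.lookup ?\<delta> x = 0"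
    using insert.hyps insert.prems by (auto simp: lookup_add lookup_sum lookup_single when_def)
  \<comment> \<open>\<open>fold_insert2\<close> applies the factor of \<open>x\<close> first, to the
    monomial itself; the induction hypothesis then applies with \<open>c\<close> multiplied by the
    factorial.\<close>
  from partial_funpow_single[OF this, of "?\<alpha> x" c] insert show ?case
    by (simp add: fold_insert2 ac_simps del: fold_insert)
qed simp

lemma mpartial_single_self:
  "mpartial \<beta> (Poly_Mapping.single \<beta> c) = Poly_Mapping.single 0 (mfact \<beta> * c)"
proof -
  have "(\<Sum>i\<in>UNIV. Poly_Mapping.single i (Poly_Mapping.lookup \<beta> i)) = \<beta>"
    by (rule poly_mapping_eqI) (auto simp: lookup_sum lookup_single when_def)
  then show ?thesis
    using fold_partial_single[of UNIV 0 \<beta> c] by (simp add: mpartial_def mfact_def)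
qed

lemma mfact_nonzero: "mfact \<alpha> \<noteq> 0"
  by (simp add: mfact_def)

definition strictly_below :: "('n::finite \<Rightarrow>\<^sub>0 nat) \<Rightarrow> ('n \<Rightarrow>\<^sub>0 nat) set"
  where "strictly_below \<beta> =
    {\<alpha>. \<alpha> \<noteq> \<beta> \<and> (\<forall>i. Poly_Mapping.lookup \<alpha> i \<le> Poly_Mapping.lookup \<beta> i)}"

lemma finite_strictly_below: "finite (strictly_below \<beta>)"
proof (rule finite_imageD)
  have "Poly_Mapping.lookup ` strictly_below \<beta> \<subseteq> PiE UNIV (\<lambda>i. {..Poly_Mapping.lookup \<beta> i})"
    by (auto simp: strictly_below_def)
  then show "finite (Poly_Mapping.lookup ` strictly_below \<beta>)"
    by (rule finite_subset) (intro finite_PiE, auto)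
qed (rule inj_onI, simp add: poly_mapping_eqI)

text \<open>The total degree is the measure behind both the induction rule and the termination of
  \<open>diffop_coeff\<close>.\<close>

lemma strictly_below_degree_less:
  assumes "\<alpha> \<in> strictly_below \<beta>"
  shows "(\<Sum>i\<in>UNIV. Poly_Mapping.lookup \<alpha> i) < (\<Sum>i\<in>UNIV. Poly_Mapping.lookup \<beta> i)"
proof (rule sum_strict_mono_ex1)
  show "\<exists>i\<in>UNIV. Poly_Mapping.lookup \<alpha> i < Poly_Mapping.lookup \<beta> i"
    using assms by (metis (mono_tags, lifting) UNIV_I le_neq_implies_less mem_Collect_eq
        poly_mapping_eqI strictly_below_def)
qed (use assms in \<open>auto simp: strictly_below_def\<close>)

lemma strictly_below_induct:
  assumes "\<And>\<beta>. (\<And>\<alpha>. \<alpha> \<in> strictly_below \<beta> \<Longrightarrow> P \<alpha>) \<Longrightarrow> P \<beta>"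
  shows "P \<beta>"
  by (induction \<beta> rule: measure_induct_rule[where f = "\<lambda>\<beta>. \<Sum>i\<in>UNIV. Poly_Mapping.lookup \<beta> i"])
     (blast intro: assms strictly_below_degree_less)

definition lower_terms ::
    "(('n::finite \<Rightarrow>\<^sub>0 nat) \<Rightarrow> 'v::real_vector \<Rightarrow> ('n, 'v) vpoly) \<Rightarrow> ('n \<Rightarrow>\<^sub>0 nat) \<Rightarrow> 'v \<Rightarrow> ('n, 'v) vpoly"
  where "lower_terms Q \<beta> v =
    (\<Sum>\<alpha>\<in>strictly_below \<beta>. (1 / mfact \<alpha>) *\<^sub>R (Q \<alpha> v \<odot> mpartial \<alpha> (Poly_Mapping.single \<beta> 1)))"

text \<open>Tells the function package that \<open>Q\<close> is evaluated only at exponents in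
  \<open>strictly_below \<beta>\<close>, which yields the termination conditions of
  \<open>diffop_coeff\<close>.\<close>

lemma lower_terms_cong [fundef_cong]:
  assumes "\<beta> = \<beta>'" "v = v'" "\<And>\<alpha>. \<alpha> \<in> strictly_below \<beta>' \<Longrightarrow> Q \<alpha> v' = Q' \<alpha> v'"
  shows "lower_terms Q \<beta> v = lower_terms Q' \<beta>' v'"
  using assms by (simp add: lower_terms_def)

lemma linear_lower_terms:
  assumes "\<And>\<alpha>. \<alpha> \<in> strictly_below \<beta> \<Longrightarrow> linear (Q \<alpha>)"
  shows "linear (lower_terms Q \<beta>)"
proof -
  have "linear (\<lambda>v. Q \<alpha> v \<odot> p)" if "\<alpha> \<in> strictly_below \<beta>" for \<alpha> p
    using linear_compose[OF assms[OF that] vpoly_mult_linear] by (simp add: o_def)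
  then have "linear (\<lambda>v. lower_terms Q \<beta> v)"
    unfolding lower_terms_def
    by (intro linear_compose_sum ballI linear_compose_scale_right)
  then show ?thesis .
qed

text \<open>This is row \<open>\<beta>\<close> of the triangular system: the weight
  \<open>1 / mfact \<beta>\<close> cancels the constant produced by
  \<open>mpartial_single_self\<close>, so the diagonal entry is the identity.\<close>

lemma diffop_series_single:
  assumes "\<And>\<alpha>. linear (Q \<alpha>)"
  shows "diffop_series Q (Poly_Mapping.single \<beta> v) = Q \<beta> v + lower_terms Q \<beta> v"
proof -
  let ?t = "\<lambda>\<alpha>. (1 / mfact \<alpha>) *\<^sub>R (Q \<alpha> v \<odot> mpartial \<alpha> (Poly_Mapping.single \<beta> 1))"
  have "?t \<alpha> = 0" if \<alpha>: "\<alpha> \<notin> insert \<beta> (strictly_below \<beta>)" for \<alpha>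
  proof -
    obtain i where "Poly_Mapping.lookup \<beta> i < Poly_Mapping.lookup \<alpha> i"
      using \<alpha> by (auto simp: strictly_below_def not_le)
    then show ?thesis
      by (simp add: mpartial_single_eq_0 vpoly_mult_def)
  qed
  then have "{\<alpha>. ?t \<alpha> \<noteq> 0} \<subseteq> insert \<beta> (strictly_below \<beta>)"
    by blast
  then have "Sum_any ?t = sum ?t (insert \<beta> (strictly_below \<beta>))"
    by (intro Sum_any.expand_superset) (simp_all add: finite_strictly_below)
  also have "\<dots> = ?t \<beta> + lower_terms Q \<beta> v"
    by (subst sum.insert)
       (simp_all add: finite_strictly_below lower_terms_def, simp add: strictly_below_def)
  also have "?t \<beta> = Q \<beta> v"
    by (simp add: mpartial_single_self vpoly_mult_const mfact_nonzero)
  finally show ?thesis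
    by (simp add: diffop_series_def op_times_partial_single[OF assms])
qed

text \<open>The support summed over by \<open>Sum_any\<close> varies with the polynomial, so the
  sums are first rewritten over a common finite index set.\<close>

lemma linear_diffop_series:
  fixes Q :: "('n::finite \<Rightarrow>\<^sub>0 nat) \<Rightarrow> 'v::real_vector \<Rightarrow> ('n, 'v) vpoly"
  assumes "\<And>\<alpha>. linear (Q \<alpha>)"
  shows "linear (diffop_series Q)"
proof -
  let ?L = "\<lambda>\<alpha>. op_times_partial (Q \<alpha>) \<alpha>"
  let ?N = "\<lambda>f. {\<alpha>. ?L \<alpha> f \<noteq> 0}"
  note lin = linear_op_times_partial[OF assms]
  have expand: "diffop_series Q f = (\<Sum>\<alpha>\<in>A. (1 / mfact \<alpha>) *\<^sub>R ?L \<alpha> f)"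
    if "finite A" "?N f \<subseteq> A" for f A
    unfolding diffop_series_def using that by (intro Sum_any.expand_superset) auto
  show ?thesis
  proof (rule linearI)
    fix f g :: "('n, 'v) vpoly" and a :: real
    \<comment> \<open>By additivity of each \<open>?L \<alpha>\<close>, this set also contains
      \<open>?N (f + g)\<close>.\<close>
    let ?A = "?N f \<union> ?N g"
    have "finite ?A"
      by (simp add: finite_op_times_partial)
    then show "diffop_series Q (f + g) = diffop_series Q f + diffop_series Q g"
      by (subst (1 2 3) expand[where A = ?A])
         (auto simp: linear_add[OF lin] scaleR_add_right sum.distrib)
    show "diffop_series Q (a *\<^sub>R f) = a *\<^sub>R diffop_series Q f"
      by (subst (1 2) expand[where A = "?N f"])
         (auto simp: finite_op_times_partial linear_scale[OF lin] scaleR_sum_right mult.commute)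
  qed
qed

text \<open>Forward substitution: the exponent descends while \<open>v\<close> stays fixed. The
  eta-expanded argument makes the recursive calls fully applied, matching
  \<open>lower_terms_cong\<close>.\<close>

function diffop_coeff ::
    "(('n::finite, 'v::real_vector) vpoly \<Rightarrow> ('n, 'v) vpoly) \<Rightarrow> ('n \<Rightarrow>\<^sub>0 nat) \<Rightarrow> 'v \<Rightarrow> ('n, 'v) vpoly"
  where "diffop_coeff T \<beta> v =
    T (Poly_Mapping.single \<beta> v) - lower_terms (\<lambda>\<alpha> w. diffop_coeff T \<alpha> w) \<beta> v"
  by auto
termination
  by (relation "measure (\<lambda>(T, \<beta>, v). \<Sum>i\<in>UNIV. Poly_Mapping.lookup \<beta> i)")
     (auto intro: strictly_below_degree_less)

declare diffop_coeff.simps [simp del]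

text \<open>The recursion is pointwise in \<open>v\<close>, so linearity is recovered by induction:
  each coefficient is a difference of linear maps.\<close>

lemma linear_diffop_coeff:
  assumes "linear T"
  shows "linear (diffop_coeff T \<beta>)"
proof (induction \<beta> rule: strictly_below_induct)
  case (1 \<beta>)
  have "linear (\<lambda>v. T (Poly_Mapping.single \<beta> v))"
    using linear_compose[OF linear_single assms] by (simp add: o_def)
  from linear_compose_sub[OF this linear_lower_terms[of \<beta> "diffop_coeff T", OF 1]]
  have "linear (\<lambda>v. diffop_coeff T \<beta> v)"
    by (subst diffop_coeff.simps)
  then show ?case .
qed

theorem lemma3p1:
  fixes T :: "('n::finite, 'v::real_vector) vpoly \<Rightarrow> ('n, 'v) vpoly"
  assumes "linear T"
  shows "\<exists>!Q :: ('n \<Rightarrow>\<^sub>0 nat) \<Rightarrow> 'v \<Rightarrow> ('n, 'v) vpoly.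
           (\<forall>\<alpha>. linear (Q \<alpha>)) \<and> T = diffop_series Q"
proof (rule ex1I)
  note lin = linear_diffop_coeff[OF assms]
  have "T = diffop_series (diffop_coeff T)"
  proof (rule linear_eq_on_singles[OF assms linear_diffop_series[OF lin]])
    show "T (Poly_Mapping.single \<beta> v) = diffop_series (diffop_coeff T) (Poly_Mapping.single \<beta> v)" for \<beta> v
      by (simp add: diffop_series_single[OF lin] diffop_coeff.simps[of T \<beta> v])
  qed
  with lin show "(\<forall>\<alpha>. linear (diffop_coeff T \<alpha>)) \<and> T = diffop_series (diffop_coeff T)"
    by blast
next
  fix Q
  assume "(\<forall>\<alpha>. linear (Q \<alpha>)) \<and> T = diffop_series Q"
  \<comment> \<open>Any solution satisfies the recursion that defines
    \<open>diffop_coeff\<close>.\<close>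
  then have eq: "Q \<beta> v = T (Poly_Mapping.single \<beta> v) - lower_terms Q \<beta> v" for \<beta> v
    by (simp add: diffop_series_single)
  have "Q \<beta> = diffop_coeff T \<beta>" for \<beta>
  proof (induction \<beta> rule: strictly_below_induct)
    case (1 \<beta>)
    then have "lower_terms Q \<beta> v = lower_terms (diffop_coeff T) \<beta> v" for v
      by (intro lower_terms_cong) simp_all
    then show ?case
      by (simp add: fun_eq_iff eq[of \<beta>] diffop_coeff.simps)
  qed
  then show "Q = diffop_coeff T" ..
qed

end
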